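(* Let $p\in(0,\tfrac12]$, $\rho\in(0,1)$ and $\varepsilon>0$. Let $r=\frac{\log(2/\varepsilon)}{\log(1/\rho)}$ and $\delta=10^{-3r-1}\varepsilon^3$. Suppose that $f\colon\{0,1\}^n\to\{0,1\}$ is an $(r,\delta)$-global Boolean function with $\mu_p(f)<\delta$. Then $\mathrm{Stab}_\rho(f)\le\varepsilon\,\mu_p(f)$.
   Context: $\mu_p$ is the $p$-biased product measure on $\{0,1\}^n$, $\mu_p(f)=\mathbb{E}_{\mu_p}[f]$. A Boolean $f$ is $(r,\delta)$-global if $\mu_p(f_{J\to1})\le\mu_p(f)+\delta$ for every $J\subseteq[n]$ with $|J|\le r$, where $f_{J\to1}$ is the restriction setting coordinates in $J$ to $1$. The noise operator is $\mathrm{T}_\rho f(x)=\mathbb{E}_{\mathbf{y}\sim N_\rho(x)}[f(\mathbf{y})]$ (each $\mathbf{y}_i=x_i$ with probability $\rho$, otherwise resampled with $\Pr[\mathbf{y}_i=1]=p$), and $\mathrm{Stab}_\rho(f)=\mathbb{E}_{\mu_p}[f\,\mathrm{T}_\rho f]$. *)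

theory Defs
  imports "HOL-Probability.Probability"
begin

text \<open>
  A point of \<open>{0,1}\<^sup>I\<close> is a function \<open>nat \<Rightarrow> bool\<close> (\<open>True\<close> for 1) that is \<open>False\<close> outside \<open>I\<close>.
  The index set is a parameter, since a restriction of a function on \<open>{0,1}\<^sup>n\<close> that fixes the
  coordinates in \<open>J\<close> is a function on \<open>{0,1}\<close> to the power \<open>{1..n} - J\<close>.
\<close>

definition cube :: "nat set \<Rightarrow> (nat \<Rightarrow> bool) set" where
  "cube I = PiE_dflt I False (\<lambda>_. UNIV)"

definition biased_pmf :: "real \<Rightarrow> nat set \<Rightarrow> (nat \<Rightarrow> bool) pmf" where
  "biased_pmf p I = Pi_pmf I False (\<lambda>_. bernoulli_pmf p)"

definition mu :: "real \<Rightarrow> nat set \<Rightarrow> ((nat \<Rightarrow> bool) \<Rightarrow> real) \<Rightarrow> real" where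
  "mu p I f = measure_pmf.expectation (biased_pmf p I) f"

definition boolean_fun :: "nat set \<Rightarrow> ((nat \<Rightarrow> bool) \<Rightarrow> real) \<Rightarrow> bool" where
  "boolean_fun I f \<longleftrightarrow> (\<forall>x\<in>cube I. f x \<in> {0, 1})"

definition restrict_to_1 :: "((nat \<Rightarrow> bool) \<Rightarrow> real) \<Rightarrow> nat set \<Rightarrow> (nat \<Rightarrow> bool) \<Rightarrow> real" where
  "restrict_to_1 f J = (\<lambda>x. f (\<lambda>i. if i \<in> J then True else x i))"

text \<open>The threshold \<open>r\<close> is a real number; it need not be an integer.\<close>

definition global_fun ::
  "real \<Rightarrow> nat set \<Rightarrow> real \<Rightarrow> real \<Rightarrow> ((nat \<Rightarrow> bool) \<Rightarrow> real) \<Rightarrow> bool" where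
  "global_fun p I r \<delta> f \<longleftrightarrow>
     (\<forall>J\<subseteq>I. real (card J) \<le> r \<longrightarrow> mu p (I - J) (restrict_to_1 f J) \<le> mu p I f + \<delta>)"

definition noise_pmf :: "real \<Rightarrow> nat set \<Rightarrow> real \<Rightarrow> (nat \<Rightarrow> bool) \<Rightarrow> (nat \<Rightarrow> bool) pmf" where
  "noise_pmf p I \<rho> x = Pi_pmf I False
     (\<lambda>i. bind_pmf (bernoulli_pmf \<rho>)
        (\<lambda>keep. if keep then return_pmf (x i) else bernoulli_pmf p))"

definition noise_op ::
  "real \<Rightarrow> nat set \<Rightarrow> real \<Rightarrow> ((nat \<Rightarrow> bool) \<Rightarrow> real) \<Rightarrow> (nat \<Rightarrow> bool) \<Rightarrow> real" where
  "noise_op p I \<rho> f x = measure_pmf.expectation (noise_pmf p I \<rho> x) f"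

definition Stab :: "real \<Rightarrow> nat set \<Rightarrow> real \<Rightarrow> ((nat \<Rightarrow> bool) \<Rightarrow> real) \<Rightarrow> real" where
  "Stab p I \<rho> f = mu p I (\<lambda>x. f x * noise_op p I \<rho> f x)"

end

theory Submission imports Defs begin

text \<open>
  Let \<open>d = \<lfloor>r\<rfloor>\<close>. As \<open>\<rho>\<^sup>r = \<epsilon>/2\<close>, the Fourier levels above \<open>d\<close> contribute at most
  \<open>(\<epsilon>/2) \<mu>(f)\<close> to the stability, so it suffices to bound the weight \<open>W\<close> of the low-degree part
  \<open>g\<close> of \<open>f\<close> by \<open>(\<epsilon>/2) \<mu>(f)\<close>. Two applications of Cauchy--Schwarz to \<open>W = \<mu>(f g)\<close> give
  \<open>W\<^sup>4 \<le> \<mu>(f)\<^sup>3 \<mu>(g\<^sup>4)\<close>. A hypercontractive inequality bounds \<open>\<mu>(g\<^sup>4)\<close> by the squares of the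
  Fourier tails over \<open>T \<supseteq> S\<close>. Such a tail of \<open>f\<close> is the second moment of a discrete derivative
  of \<open>f\<close>, which globalness makes small; replacing one of the two factors of each square by this
  bound and keeping the other leaves \<open>\<mu>(g\<^sup>4) \<le> 52\<^sup>d \<delta> W\<close>, hence \<open>W\<^sup>3 \<le> \<mu>(f)\<^sup>3 52\<^sup>d \<delta>\<close>.
\<close>

section \<open>Expectation over the biased cube, one coordinate at a time\<close>

lemma cube_upd: "x \<in> cube I \<Longrightarrow> x(i := b) \<in> cube (insert i I)"
  by (auto simp: cube_def PiE_dflt_def)

lemma restrict_mem_cube:
  "x \<in> cube (I - J) \<Longrightarrow> J \<subseteq> I \<Longrightarrow> (\<lambda>i. if i \<in> J then True else x i) \<in> cube I"
  by (auto simp: cube_def PiE_dflt_def split: if_splits)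

lemma set_biased_pmf_subset: "finite I \<Longrightarrow> set_pmf (biased_pmf p I) \<subseteq> cube I"
  by (auto simp: biased_pmf_def cube_def PiE_dflt_def set_Pi_pmf)

lemma finite_cube: "finite I \<Longrightarrow> finite (cube I)"
  unfolding cube_def by (rule finite_PiE_dflt) auto

lemma finite_set_Pi_pmf_bool:
  "finite I \<Longrightarrow> finite (set_pmf (Pi_pmf I False (q :: nat \<Rightarrow> bool pmf)))"
  by (rule finite_subset[OF _ finite_cube])
     (auto simp: cube_def PiE_dflt_def set_Pi_pmf)

lemma integrable_biased_pmf: "finite I \<Longrightarrow> integrable (biased_pmf p I) (f :: _ \<Rightarrow> real)"
  by (simp add: biased_pmf_def integrable_measure_pmf_finite finite_set_Pi_pmf_bool)

lemma mu_cong: "finite I \<Longrightarrow> (\<And>x. x \<in> cube I \<Longrightarrow> f x = g x) \<Longrightarrow> mu p I f = mu p I g"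
  unfolding mu_def using set_biased_pmf_subset[of I p]
  by (intro integral_cong_AE) (auto simp: AE_measure_pmf_iff)

lemma mu_mono: "finite I \<Longrightarrow> (\<And>x. x \<in> cube I \<Longrightarrow> f x \<le> g x) \<Longrightarrow> mu p I f \<le> mu p I g"
  unfolding mu_def using set_biased_pmf_subset[of I p]
  by (intro integral_mono_AE integrable_biased_pmf) (auto simp: AE_measure_pmf_iff)

lemma mu_nonneg: "finite I \<Longrightarrow> (\<And>x. x \<in> cube I \<Longrightarrow> 0 \<le> f x) \<Longrightarrow> 0 \<le> mu p I f"
  using mu_mono[of I "\<lambda>_. 0" f p] by (simp add: mu_def)

lemma mu_add: "finite I \<Longrightarrow> mu p I (\<lambda>x. f x + g x) = mu p I f + mu p I g"
  unfolding mu_def by (intro Bochner_Integration.integral_add integrable_biased_pmf)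

lemma mu_cmult: "mu p I (\<lambda>x. c * f x) = c * mu p I f"
  by (simp add: mu_def)

lemma mu_sum: "finite I \<Longrightarrow> mu p I (\<lambda>x. \<Sum>s\<in>A. f s x) = (\<Sum>s\<in>A. mu p I (f s))"
  unfolding mu_def by (intro Bochner_Integration.integral_sum integrable_biased_pmf)

text \<open>Condition on coordinate \<open>i\<close>, which is independent of the others. The
  coordinates may have different laws \<open>q j\<close>, so that the same formula serves both
  \<open>biased_pmf\<close> and \<open>noise_pmf\<close>.\<close>

lemma expectation_Pi_pmf_insert:
  fixes q :: "nat \<Rightarrow> bool pmf" and h :: "(nat \<Rightarrow> bool) \<Rightarrow> real"
  assumes "finite I" "i \<notin> I"
  shows "measure_pmf.expectation (Pi_pmf (insert i I) False q) h =
    pmf (q i) True * measure_pmf.expectation (Pi_pmf I False q) (\<lambda>x. h (x(i := True))) +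
    pmf (q i) False * measure_pmf.expectation (Pi_pmf I False q) (\<lambda>x. h (x(i := False)))"
proof -
  have eq: "Pi_pmf (insert i I) False q =
      bind_pmf (q i) (\<lambda>y. map_pmf (\<lambda>f. f(i := y)) (Pi_pmf I False q))"
    unfolding Pi_pmf_insert'[OF assms] map_pmf_def ..
  show ?thesis
    unfolding eq
    by (subst pmf_expectation_bind[where A = UNIV])
       (auto simp: UNIV_bool finite_set_Pi_pmf_bool assms)
qed

lemma mu_insert:
  assumes "finite I" "i \<notin> I" "0 \<le> p" "p \<le> 1"
  shows "mu p (insert i I) f =
    p * mu p I (\<lambda>x. f (x(i := True))) + (1 - p) * mu p I (\<lambda>x. f (x(i := False)))"
  unfolding mu_def biased_pmf_def using assms by (simp add: expectation_Pi_pmf_insert)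

lemma noise_pmf_cong: "(\<And>j. j \<in> I \<Longrightarrow> x j = y j) \<Longrightarrow> noise_pmf p I \<rho> x = noise_pmf p I \<rho> y"
  unfolding noise_pmf_def by (intro Pi_pmf_cong refl) (simp cong: if_cong)

text \<open>Noise acts on each coordinate separately: coordinate \<open>i\<close> of the noisy point
  is kept with probability \<rho> and otherwise redrawn, and the law of the other coordinates does
  not see \<open>b\<close>.\<close>

lemma noise_op_insert:
  assumes "finite I" "i \<notin> I" "0 \<le> p" "p \<le> 1" "0 \<le> \<rho>" "\<rho> \<le> 1"
  shows "noise_op p (insert i I) \<rho> f (x(i := b)) =
    (\<rho> * of_bool b + (1 - \<rho>) * p) * noise_op p I \<rho> (\<lambda>x. f (x(i := True))) x +
    (\<rho> * of_bool (\<not> b) + (1 - \<rho>) * (1 - p)) * noise_op p I \<rho> (\<lambda>x. f (x(i := False))) x"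
proof -
  have *: "noise_pmf p I \<rho> (x(i := b)) = noise_pmf p I \<rho> x"
    using assms by (intro noise_pmf_cong) auto
  show ?thesis
    unfolding noise_op_def *[symmetric]
    unfolding noise_pmf_def using assms
    by (subst expectation_Pi_pmf_insert) (auto simp: pmf_bind pmf_return)
qed

section \<open>Fourier analysis under the biased measure\<close>

definition phi :: "real \<Rightarrow> bool \<Rightarrow> real" where
  "phi p b = (if b then 1 - p else - p) / sqrt (p * (1 - p))"

text \<open>\<open>phi p\<close> has mean 0 and variance 1 for a p-biased bit, so these products are
  the orthonormal p-biased Fourier characters.\<close>

definition chi :: "real \<Rightarrow> nat set \<Rightarrow> (nat \<Rightarrow> bool) \<Rightarrow> real" where
  "chi p S x = (\<Prod>i\<in>S. phi p (x i))"

definition fourier :: "real \<Rightarrow> nat set \<Rightarrow> ((nat \<Rightarrow> bool) \<Rightarrow> real) \<Rightarrow> nat set \<Rightarrow> real" where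
  "fourier p I f S = mu p I (\<lambda>x. f x * chi p S x)"

text \<open>The coefficients are arbitrary, which covers truncations of \<open>f\<close> as well as
  the shifted families \<open>\<lambda>T. a (insert i T)\<close> that arise in inductions on
  \<open>I\<close>.\<close>

definition fourier_sum :: "real \<Rightarrow> nat set \<Rightarrow> (nat set \<Rightarrow> real) \<Rightarrow> (nat \<Rightarrow> bool) \<Rightarrow> real" where
  "fourier_sum p I a x = (\<Sum>S\<in>Pow I. a S * chi p S x)"

lemma chi_upd: "i \<notin> S \<Longrightarrow> chi p S (x(i := b)) = chi p S x"
  unfolding chi_def by (intro prod.cong) auto

lemma chi_insert_upd:
  "finite S \<Longrightarrow> i \<notin> S \<Longrightarrow> chi p (insert i S) (x(i := b)) = phi p b * chi p S x"
  using chi_upd[of i S p x b] by (simp add: chi_def)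

lemma sum_Pow_insert:
  fixes F :: "'a set \<Rightarrow> real"
  assumes "finite I" "i \<notin> I"
  shows "(\<Sum>S\<in>Pow (insert i I). F S) = (\<Sum>S\<in>Pow I. F S + F (insert i S))"
proof -
  have inj: "inj_on (insert i) (Pow I)"
    using assms by (auto simp: inj_on_def)
  have "(\<Sum>S\<in>Pow (insert i I). F S) = (\<Sum>S\<in>Pow I. F S) + (\<Sum>S\<in>insert i ` Pow I. F S)"
    unfolding Pow_insert using assms by (intro sum.union_disjoint) auto
  also have "(\<Sum>S\<in>insert i ` Pow I. F S) = (\<Sum>S\<in>Pow I. F (insert i S))"
    by (simp add: sum.reindex[OF inj])
  finally show ?thesis by (simp add: sum.distrib)
qed

lemma fourier_insert:
  assumes "finite I" "i \<notin> I" "S \<subseteq> I" "0 \<le> p" "p \<le> 1"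
  shows "fourier p (insert i I) f S =
    p * fourier p I (\<lambda>x. f (x(i := True))) S + (1 - p) * fourier p I (\<lambda>x. f (x(i := False))) S"
proof -
  have "i \<notin> S" using assms by auto
  then show ?thesis
    unfolding fourier_def using assms by (simp add: mu_insert chi_upd)
qed

text \<open>Averaging against \<open>phi p\<close> in coordinate \<open>i\<close> takes the
  difference of the two restrictions. So the coefficients of sets containing \<open>i\<close> are
  those of a discrete derivative in direction \<open>i\<close>.\<close>

lemma fourier_insert_insert:
  assumes "finite I" "i \<notin> I" "S \<subseteq> I" "0 < p" "p < 1"
  shows "fourier p (insert i I) f (insert i S) = sqrt (p * (1 - p)) *
    (fourier p I (\<lambda>x. f (x(i := True))) S - fourier p I (\<lambda>x. f (x(i := False))) S)"
proof -
  have iS: "i \<notin> S" "finite S" using assms finite_subset by auto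
  have s: "sqrt (p * (1 - p)) \<noteq> 0" using assms by simp
  have sq: "p * (1 - p) = sqrt (p * (1 - p)) * sqrt (p * (1 - p))" using assms by simp
  have pT: "p * phi p True = sqrt (p * (1 - p))"
    unfolding phi_def using s sq by (simp add: field_simps)
  have pF: "(1 - p) * phi p False = - sqrt (p * (1 - p))"
    unfolding phi_def using s sq by (simp add: field_simps)
  have "fourier p (insert i I) f (insert i S) =
      p * mu p I (\<lambda>x. phi p True * (f (x(i := True)) * chi p S x)) +
      (1 - p) * mu p I (\<lambda>x. phi p False * (f (x(i := False)) * chi p S x))"
    unfolding fourier_def using assms iS
    by (simp add: mu_insert chi_insert_upd mult_ac)
  also have "\<dots> = p * phi p True * fourier p I (\<lambda>x. f (x(i := True))) S +
      (1 - p) * phi p False * fourier p I (\<lambda>x. f (x(i := False))) S"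
    unfolding mu_cmult fourier_def by simp
  finally show ?thesis unfolding pT pF by (simp add: algebra_simps)
qed

lemma mu_empty: "mu p {} f = f (\<lambda>_. False)"
  by (simp add: mu_def biased_pmf_def)

text \<open>The noise operator is diagonal in the characters, with eigenvalue
  \<open>\<rho> ^ card S\<close>. Two functions are needed in the induction, because splitting off
  \<open>i\<close> pairs each restriction of \<open>f\<close> with both restrictions of
  \<open>g\<close>.\<close>

lemma noise_form_expansion:
  assumes "finite I" "0 < p" "p < 1" "0 \<le> \<rho>" "\<rho> \<le> 1"
  shows "mu p I (\<lambda>x. f x * noise_op p I \<rho> g x) =
    (\<Sum>S\<in>Pow I. \<rho> ^ card S * (fourier p I f S * fourier p I g S))"
  using assms(1)
proof (induction I arbitrary: f g rule: finite_induct)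
  case empty
  then show ?case
    by (simp add: mu_empty noise_op_def noise_pmf_def fourier_def chi_def)
next
  case (insert i I)
  define f1 f0 g1 g0 where "f1 = (\<lambda>x. f (x(i := True)))" and "f0 = (\<lambda>x. f (x(i := False)))"
    and "g1 = (\<lambda>x. g (x(i := True)))" and "g0 = (\<lambda>x. g (x(i := False)))"
  note defs = f1_def f0_def g1_def g0_def
  let ?B = "\<lambda>f g. mu p I (\<lambda>x. f x * noise_op p I \<rho> g x)"
  have lin: "mu p I (\<lambda>x. h x * (a * noise_op p I \<rho> g1 x + b * noise_op p I \<rho> g0 x)) =
      a * ?B h g1 + b * ?B h g0" for h a b
    proof -
    have "mu p I (\<lambda>x. h x * (a * noise_op p I \<rho> g1 x + b * noise_op p I \<rho> g0 x)) =
        mu p I (\<lambda>x. a * (h x * noise_op p I \<rho> g1 x) + b * (h x * noise_op p I \<rho> g0 x))"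
      by (simp add: algebra_simps)
    then show ?thesis by (simp add: mu_add mu_cmult insert.hyps)
  qed
  have "mu p (insert i I) (\<lambda>x. f x * noise_op p (insert i I) \<rho> g x) =
     p * ((\<rho> + (1 - \<rho>) * p) * ?B f1 g1 + (1 - \<rho>) * (1 - p) * ?B f1 g0) +
     (1 - p) * ((1 - \<rho>) * p * ?B f0 g1 + (\<rho> + (1 - \<rho>) * (1 - p)) * ?B f0 g0)"
    using insert assms
    by (simp add: mu_insert noise_op_insert lin flip: defs)
  also have "\<dots> = (\<Sum>S\<in>Pow I. \<rho> ^ card S * (
     p * ((\<rho> + (1 - \<rho>) * p) * (fourier p I f1 S * fourier p I g1 S) +
       (1 - \<rho>) * (1 - p) * (fourier p I f1 S * fourier p I g0 S)) +
     (1 - p) * ((1 - \<rho>) * p * (fourier p I f0 S * fourier p I g1 S) +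
       (\<rho> + (1 - \<rho>) * (1 - p)) * (fourier p I f0 S * fourier p I g0 S))))"
    unfolding insert.IH sum_distrib_left sum.distrib[symmetric]
    by (intro sum.cong refl) (simp add: algebra_simps)
  \<comment> \<open>For each \<open>S\<close> the 2 by 2 form splits into the product of the
    averages over coordinate \<open>i\<close> (the set \<open>S\<close>) and \<rho> times
    \<open>p * (1 - p)\<close> times the product of the differences (the set
    \<open>insert i S\<close>).\<close>
  also have "\<dots> = (\<Sum>S\<in>Pow (insert i I). \<rho> ^ card S *
      (fourier p (insert i I) f S * fourier p (insert i I) g S))"
    unfolding sum_Pow_insert[OF insert.hyps]
  proof (intro sum.cong refl, goal_cases)
    case (1 S)
    have S: "S \<subseteq> I" using 1 by auto
    have fin: "finite S" "i \<notin> S" using S insert finite_subset by auto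
    have sq: "sqrt (p * (1 - p)) * u * (sqrt (p * (1 - p)) * v) = p * (1 - p) * (u * v)" for u v
    proof -
      have "sqrt (p * (1 - p)) * sqrt (p * (1 - p)) = p * (1 - p)" using assms by simp
      then show ?thesis by algebra
    qed
    show ?case
      using S fin insert assms
      by (simp add: fourier_insert fourier_insert_insert sq flip: defs) (simp add: algebra_simps)
  qed
  finally show ?case .
qed

text \<open>The case \<rho> = 1 of the expansion: without noise the operator is the identity on the
  cube.\<close>

lemma parseval:
  assumes "finite I" "0 < p" "p < 1"
  shows "mu p I (\<lambda>x. f x * g x) = (\<Sum>S\<in>Pow I. fourier p I f S * fourier p I g S)"
proof -
  have b1: "bernoulli_pmf 1 = return_pmf True"
    by (rule pmf_eqI, case_tac i) (simp_all add: pmf_return)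
  have "noise_op p I 1 g x = g x" if "x \<in> cube I" for x
  proof -
    have "(\<lambda>i. if i \<in> I then x i else False) = x"
      using that by (auto simp: cube_def PiE_dflt_def fun_eq_iff)
    then show ?thesis
      unfolding noise_op_def noise_pmf_def b1
      by (simp add: bind_return_pmf Pi_pmf_return_pmf assms)
  qed
  then have "mu p I (\<lambda>x. f x * g x) = mu p I (\<lambda>x. f x * noise_op p I 1 g x)"
    by (intro mu_cong assms) simp
  then show ?thesis
    using noise_form_expansion[OF assms, of 1 f g] by simp
qed


section \<open>Hypercontractivity in terms of Fourier tails\<close>

lemma fourier_sum_insert:
  assumes "finite I" "i \<notin> I"
  shows "fourier_sum p (insert i I) a (x(i := b)) =
    fourier_sum p I a x + phi p b * fourier_sum p I (\<lambda>T. a (insert i T)) x"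
proof -
  have "i \<notin> S" "finite S" if "S \<in> Pow I" for S
    using that assms finite_subset by auto
  then show ?thesis
    unfolding fourier_sum_def sum_Pow_insert[OF assms]
    by (simp add: chi_upd chi_insert_upd sum.distrib sum_distrib_left mult_ac)
qed

text \<open>The one-coordinate step of the induction: \<open>A + phi p b * H\<close> and
  \<open>B + phi p b * K\<close> are the two functions split at that coordinate. Expanding in powers
  of \<open>phi p b\<close> leaves only its first four moments.\<close>

lemma two_point_inequality:
  fixes A B H K :: real
  assumes "0 < p" "p < 1"
  shows "p * ((A + phi p True * H)\<^sup>2 * (B + phi p True * K)\<^sup>2) +
      (1 - p) * ((A + phi p False * H)\<^sup>2 * (B + phi p False * K)\<^sup>2)
    \<le> A\<^sup>2 * B\<^sup>2 + 4 * (A\<^sup>2 * K\<^sup>2 + H\<^sup>2 * B\<^sup>2) + 3 / (p * (1 - p)) * (H\<^sup>2 * K\<^sup>2)"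
proof -
  define s where "s = sqrt (p * (1 - p))"
  have s0: "s > 0" and s2: "s\<^sup>2 = p * (1 - p)" using assms by (auto simp: s_def)
  have pT: "phi p True = (1 - p) / s" and pF: "phi p False = - p / s"
    by (simp_all add: phi_def s_def)
  \<comment> \<open>\<open>k\<close> and \<open>m\<close> are the third and fourth moments of
    \<open>phi p\<close>, as \<open>m3\<close> and \<open>m4\<close> verify.\<close>
  define k where "k = (1 - 2 * p) / s"
  define m where "m = (1 - 3 * s\<^sup>2) / s\<^sup>2"
  have m1: "p * phi p True + (1 - p) * phi p False = 0"
    unfolding pT pF using s0 by (simp add: field_simps)
  have m2: "p * (phi p True)\<^sup>2 + (1 - p) * (phi p False)\<^sup>2 = 1"
  proof -
    have "p * (phi p True)\<^sup>2 + (1 - p) * (phi p False)\<^sup>2 = (p * (1 - p)) / s\<^sup>2"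
      unfolding pT pF using s0 by (simp add: divide_simps) algebra
    then show ?thesis using s0 by (simp flip: s2)
  qed
  have m3: "p * (phi p True)^3 + (1 - p) * (phi p False)^3 = k"
  proof -
    have "p * (phi p True)^3 + (1 - p) * (phi p False)^3 = (p * (1 - p)) * (1 - 2 * p) / s^3"
      unfolding pT pF using s0 by (simp add: divide_simps) algebra
    also have "\<dots> = k"
      unfolding k_def s2[symmetric] using s0 by (simp add: power2_eq_square power3_eq_cube)
    finally show ?thesis .
  qed
  have m4: "p * (phi p True)^4 + (1 - p) * (phi p False)^4 = m"
  proof -
    have "p * (phi p True)^4 + (1 - p) * (phi p False)^4 =
        (p * (1 - p)) * (1 - 3 * (p * (1 - p))) / s^4"
      unfolding pT pF using s0 by (simp add: divide_simps) algebra
    also have "\<dots> = m"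
      unfolding m_def s2[symmetric] using s0 by (simp add: power2_eq_square power4_eq_xxxx)
    finally show ?thesis .
  qed
  have mk: "m + 2 * k\<^sup>2 \<le> 3 / (p * (1 - p))"
  proof -
    have "m + 2 * k\<^sup>2 = (1 - 3 * s\<^sup>2 + 2 * (1 - 2 * p)\<^sup>2) / s\<^sup>2"
      unfolding m_def k_def using s0 by (simp add: field_simps)
    also have "1 - 3 * s\<^sup>2 + 2 * (1 - 2 * p)\<^sup>2 = 3 - 11 * s\<^sup>2"
      using s2 by algebra
    also have "(3 - 11 * s\<^sup>2) / s\<^sup>2 \<le> 3 / s\<^sup>2"
      by (intro divide_right_mono) auto
    finally show ?thesis by (simp add: s2)
  qed
  let ?u = "A * K" and ?v = "B * H" and ?w = "H * K"
  have exp: "(A + c * H)\<^sup>2 * (B + c * K)\<^sup>2 = A\<^sup>2 * B\<^sup>2 + c * (2 * (A * B) * (?u + ?v)) +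
      c\<^sup>2 * (?u\<^sup>2 + ?v\<^sup>2 + 4 * ?u * ?v) + c^3 * (2 * (?u + ?v) * ?w) + c^4 * ?w\<^sup>2" for c
    by algebra
  have "p * ((A + phi p True * H)\<^sup>2 * (B + phi p True * K)\<^sup>2) +
      (1 - p) * ((A + phi p False * H)\<^sup>2 * (B + phi p False * K)\<^sup>2) =
      A\<^sup>2 * B\<^sup>2 + (p * phi p True + (1 - p) * phi p False) * (2 * (A * B) * (?u + ?v)) +
      (p * (phi p True)\<^sup>2 + (1 - p) * (phi p False)\<^sup>2) * (?u\<^sup>2 + ?v\<^sup>2 + 4 * ?u * ?v) +
      (p * (phi p True)^3 + (1 - p) * (phi p False)^3) * (2 * (?u + ?v) * ?w) +
      (p * (phi p True)^4 + (1 - p) * (phi p False)^4) * ?w\<^sup>2"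
    unfolding exp by (simp add: algebra_simps)
  also have "\<dots> = A\<^sup>2 * B\<^sup>2 + (?u\<^sup>2 + ?v\<^sup>2 + 4 * ?u * ?v) + k * (2 * (?u + ?v) * ?w) + m * ?w\<^sup>2"
    unfolding m1 m2 m3 m4 by simp
  \<comment> \<open>Completing squares removes the mixed terms: \<open>4 * ?u * ?v\<close> costs 2
    of each of the squares of \<open>?u\<close> and \<open>?v\<close>, and the two terms with
    \<open>k\<close> cost 1 of each and twice the square of \<open>k * ?w\<close>. Hence the 4 and
    the quantity bounded in \<open>mk\<close>.\<close>
  also have "\<dots> = A\<^sup>2 * B\<^sup>2 + 4 * (?u\<^sup>2 + ?v\<^sup>2) + (m + 2 * k\<^sup>2) * ?w\<^sup>2
      - (2 * (?u - ?v)\<^sup>2 + (?u - k * ?w)\<^sup>2 + (?v - k * ?w)\<^sup>2)"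
    by algebra
  also have "\<dots> \<le> A\<^sup>2 * B\<^sup>2 + 4 * (?u\<^sup>2 + ?v\<^sup>2) + (m + 2 * k\<^sup>2) * ?w\<^sup>2"
    using zero_le_power2[of "?u - ?v"] zero_le_power2[of "?u - k * ?w"] zero_le_power2[of "?v - k * ?w"]
    by linarith
  also have "\<dots> \<le> A\<^sup>2 * B\<^sup>2 + 4 * (?u\<^sup>2 + ?v\<^sup>2) + 3 / (p * (1 - p)) * ?w\<^sup>2"
    using mk by (intro add_left_mono mult_right_mono) auto
  finally show ?thesis by (simp add: power_mult_distrib mult_ac)
qed

text \<open>Without the weight this is the squared 2-norm of the Laplacian in the coordinates
  \<open>S\<close>, which keeps exactly the characters whose set contains \<open>S\<close>.\<close>

definition weighted_tail :: "nat set \<Rightarrow> (nat set \<Rightarrow> real) \<Rightarrow> nat set \<Rightarrow> real" where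
  "weighted_tail I a S = (\<Sum>T\<in>Pow I. if S \<subseteq> T then 4 ^ card T * (a T)\<^sup>2 else 0)"

lemma weighted_tail_nonneg: "0 \<le> weighted_tail I a S"
  unfolding weighted_tail_def by (intro sum_nonneg) auto

lemma weighted_tail_insert:
  assumes "finite I" "i \<notin> I" "S \<subseteq> I"
  shows "weighted_tail (insert i I) a S =
    weighted_tail I a S + 4 * weighted_tail I (\<lambda>T. a (insert i T)) S"
  unfolding weighted_tail_def sum_Pow_insert[OF assms(1,2)] sum.distrib sum_distrib_left
proof (intro arg_cong2[where f = "(+)"] sum.cong refl, goal_cases)
  case (1 T)
  then have "finite T" "i \<notin> T" using assms finite_subset by auto
  moreover have "S \<subseteq> insert i T \<longleftrightarrow> S \<subseteq> T" using assms by auto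
  ultimately show ?case by simp
qed

lemma weighted_tail_insert_insert:
  assumes "finite I" "i \<notin> I" "S \<subseteq> I"
  shows "weighted_tail (insert i I) a (insert i S) =
    4 * weighted_tail I (\<lambda>T. a (insert i T)) S"
  unfolding weighted_tail_def sum_Pow_insert[OF assms(1,2)] sum_distrib_left
proof (intro sum.cong refl, goal_cases)
  case (1 T)
  then have "finite T" "i \<notin> T" using assms finite_subset by auto
  moreover have "insert i S \<subseteq> insert i T \<longleftrightarrow> S \<subseteq> T" using assms by auto
  ultimately show ?case by simp
qed

text \<open>
  The statement for two functions is what makes the induction on \<open>I\<close> work: the cross terms
  \<open>\<mu>(P\<^sub>a\<^sup>2 P\<^sub>k\<^sup>2)\<close> of the inductive step are again of this form, whereas separating them with
  Cauchy--Schwarz would lose too much. The weight 4 per coordinate stands for the noise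
  operator with parameter 1/2.
\<close>

theorem global_hypercontractivity:
  assumes "finite I" "0 < p" "p < 1"
  shows "mu p I (\<lambda>x. (fourier_sum p I a x)\<^sup>2 * (fourier_sum p I b x)\<^sup>2) \<le>
    (\<Sum>S\<in>Pow I. (3 / (16 * (p * (1 - p)))) ^ card S * (weighted_tail I a S * weighted_tail I b S))"
  using assms(1)
proof (induction I arbitrary: a b rule: finite_induct)
  case empty
  then show ?case
    by (simp add: mu_empty fourier_sum_def chi_def weighted_tail_def)
next
  case (insert i I)
  define h k where "h = (\<lambda>T. a (insert i T))" and "k = (\<lambda>T. b (insert i T))"
  define w where "w = 3 / (16 * (p * (1 - p)))"
  have w0: "w \<ge> 0" using assms by (simp add: w_def)
  have w16: "3 / (p * (1 - p)) = 16 * w" by (simp add: w_def)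
  let ?P = "fourier_sum p I" and ?N = "weighted_tail I"
  let ?F = "\<lambda>a b. mu p I (\<lambda>x. (?P a x)\<^sup>2 * (?P b x)\<^sup>2)"
  let ?G = "\<lambda>a b. \<Sum>S\<in>Pow I. w ^ card S * (?N a S * ?N b S)"
  have "mu p (insert i I) (\<lambda>x. (fourier_sum p (insert i I) a x)\<^sup>2 * (fourier_sum p (insert i I) b x)\<^sup>2)
    = mu p I (\<lambda>x. p * ((?P a x + phi p True * ?P h x)\<^sup>2 * (?P b x + phi p True * ?P k x)\<^sup>2) +
      (1 - p) * ((?P a x + phi p False * ?P h x)\<^sup>2 * (?P b x + phi p False * ?P k x)\<^sup>2))"
    using insert.hyps assms
    by (simp add: mu_insert fourier_sum_insert mu_add mu_cmult h_def k_def)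
  also have "\<dots> \<le> mu p I (\<lambda>x. (?P a x)\<^sup>2 * (?P b x)\<^sup>2 +
      4 * ((?P a x)\<^sup>2 * (?P k x)\<^sup>2 + (?P h x)\<^sup>2 * (?P b x)\<^sup>2) +
      3 / (p * (1 - p)) * ((?P h x)\<^sup>2 * (?P k x)\<^sup>2))"
    by (intro mu_mono insert.hyps two_point_inequality assms)
  also have "\<dots> = ?F a b + 4 * (?F a k + ?F h b) + 16 * w * ?F h k"
    unfolding w16 using insert.hyps by (simp only: mu_add mu_cmult)
  also have "\<dots> \<le> ?G a b + 4 * (?G a k + ?G h b) + 16 * w * ?G h k"
    using w0 insert.IH[folded w_def] by (intro add_mono mult_left_mono) auto
  also have "\<dots> = (\<Sum>S\<in>Pow I. w ^ card S * (?N a S * ?N b S + 4 * (?N a S * ?N k S + ?N h S * ?N b S)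
      + 16 * w * (?N h S * ?N k S)))"
    by (simp add: sum_distrib_left sum.distrib algebra_simps)
  \<comment> \<open>The set \<open>S\<close> yields
    \<open>(?N a S + 4 * ?N h S) * (?N b S + 4 * ?N k S)\<close>, which covers the first terms;
    \<open>insert i S\<close> yields exactly the term with \<open>16 * w\<close>. The surplus
    \<open>16 * (?N h S * ?N k S)\<close> of the first product is dropped.\<close>
  also have "\<dots> \<le> (\<Sum>S\<in>Pow (insert i I). w ^ card S *
      (weighted_tail (insert i I) a S * weighted_tail (insert i I) b S))"
    unfolding sum_Pow_insert[OF insert.hyps]
  proof (intro sum_mono, goal_cases)
    case (1 S)
    have S: "S \<subseteq> I" using 1 by auto
    have fin: "finite S" "i \<notin> S" using S insert.hyps finite_subset by auto
    have pos: "0 \<le> w ^ card S * (16 * (?N h S * ?N k S))"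
      using w0 weighted_tail_nonneg by auto
    show ?case
      using S fin insert.hyps pos
      by (simp add: weighted_tail_insert weighted_tail_insert_insert flip: h_def k_def)
         (simp add: algebra_simps)
  qed
  finally show ?case unfolding w_def .
qed

section \<open>Fourier tails of Boolean functions with bounded restrictions\<close>

lemma boolean_fun_upd:
  assumes "boolean_fun (insert i I) f"
  shows "boolean_fun I (\<lambda>x. f (x(i := b)))"
  using assms cube_upd unfolding boolean_fun_def by blast

lemma boolean_fun_restrict:
  assumes "boolean_fun I f" "J \<subseteq> I"
  shows "boolean_fun (I - J) (restrict_to_1 f J)"
  using assms restrict_mem_cube unfolding boolean_fun_def restrict_to_1_def by blast

lemma mu_boolean_nonneg: "finite I \<Longrightarrow> boolean_fun I f \<Longrightarrow> 0 \<le> mu p I f"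
  by (rule mu_nonneg) (auto simp: boolean_fun_def)

lemma boolean_fun_sq: "boolean_fun I f \<Longrightarrow> x \<in> cube I \<Longrightarrow> f x * f x = f x"
  by (auto simp: boolean_fun_def)

lemma parseval_boolean:
  assumes "finite I" "0 < p" "p < 1" "boolean_fun I f"
  shows "(\<Sum>T\<in>Pow I. (fourier p I f T)\<^sup>2) = mu p I f"
proof -
  have "mu p I f = mu p I (\<lambda>x. f x * f x)"
    using assms by (intro mu_cong) (auto simp: boolean_fun_sq)
  then show ?thesis by (simp add: parseval assms power2_eq_square)
qed

text \<open>Induction on \<open>S\<close>, for all \<open>I\<close>, \<open>f\<close> and
  \<open>M\<close>, since removing a coordinate changes all three. The tail is that of a difference
  of two restrictions; \<open>(u - v)^2 <= 2 * u^2 + 2 * v^2\<close> with the bounds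
  \<open>M\<close> and \<open>2 * M\<close> for them gives the factor 2 * (1 + 2) = 6 per
  coordinate.\<close>

lemma fourier_tail_bound:
  assumes "finite I" "0 < p" "p \<le> 1 / 2" "S \<subseteq> I" "boolean_fun I f"
    and "\<And>J. J \<subseteq> S \<Longrightarrow> mu p (I - J) (restrict_to_1 f J) \<le> M"
  shows "(\<Sum>T\<in>Pow I. if S \<subseteq> T then (fourier p I f T)\<^sup>2 else 0) \<le> (6 * (p * (1 - p))) ^ card S * M"
proof -
  have "finite S" using assms finite_subset by auto
  then show ?thesis using assms
  proof (induction S arbitrary: I f M rule: finite_induct)
    case empty
    have "restrict_to_1 f {} = f" by (simp add: restrict_to_1_def)
    then show ?case using empty.prems(6)[of "{}"] parseval_boolean[of I p f] empty.prems by simp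
  next
    case (insert i S I f M)
    define I' where "I' = I - {i}"
    have I: "I = insert i I'" and i: "i \<notin> I'" and fin: "finite I'" and S: "S \<subseteq> I'"
      using insert.prems insert.hyps by (auto simp: I'_def)
    define f1 f0 where "f1 = (\<lambda>x. f (x(i := True)))" and "f0 = (\<lambda>x. f (x(i := False)))"
    have b1: "boolean_fun I' f1" and b0: "boolean_fun I' f0"
      unfolding f1_def f0_def using insert.prems I boolean_fun_upd by auto
    have m1: "mu p (I' - J) (restrict_to_1 f1 J) \<le> M" if J: "J \<subseteq> S" for J
    proof -
      have "I' - J = I - insert i J" using I i by auto
      moreover have "restrict_to_1 f1 J = restrict_to_1 f (insert i J)"
        by (auto simp: restrict_to_1_def f1_def fun_eq_iff intro!: arg_cong[of _ _ f])
      ultimately show ?thesis using insert.prems(6)[of "insert i J"] J by auto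
    qed
    \<comment> \<open>this is where \<open>p \<le> 1/2\<close> enters: a restriction to 0 costs a factor \<open>1/(1 - p) \<le> 2\<close>\<close>
    have m0: "mu p (I' - J) (restrict_to_1 f0 J) \<le> 2 * M" if J: "J \<subseteq> S" for J
    proof -
      have iJ: "i \<notin> J" using J S i by auto
      have eq: "I - J = insert i (I' - J)" using I iJ by auto
      have r: "restrict_to_1 f J (x(i := b)) = restrict_to_1 (\<lambda>x. f (x(i := b))) J x" for x b
        using iJ by (auto simp: restrict_to_1_def fun_eq_iff intro!: arg_cong[of _ _ f])
      have n1: "0 \<le> mu p (I' - J) (restrict_to_1 f1 J)" and n0: "0 \<le> mu p (I' - J) (restrict_to_1 f0 J)"
        using J S fin b1 b0 by (auto intro!: mu_boolean_nonneg boolean_fun_restrict)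
      have "mu p (I - J) (restrict_to_1 f J) =
          p * mu p (I' - J) (restrict_to_1 f1 J) + (1 - p) * mu p (I' - J) (restrict_to_1 f0 J)"
        unfolding eq f1_def f0_def using fin i insert.prems by (simp add: mu_insert r)
      moreover have "mu p (I - J) (restrict_to_1 f J) \<le> M"
        using insert.prems(6)[of J] J by auto
      moreover have "0 \<le> p * mu p (I' - J) (restrict_to_1 f1 J)"
        using n1 insert.prems by simp
      moreover have "1 / 2 * mu p (I' - J) (restrict_to_1 f0 J) \<le> (1 - p) * mu p (I' - J) (restrict_to_1 f0 J)"
        using n0 insert.prems by (intro mult_right_mono) auto
      ultimately show ?thesis by linarith
    qed
    let ?s = "p * (1 - p)"
    have s0: "?s \<ge> 0" using insert.prems by auto
    let ?Q = "\<lambda>f. \<Sum>T\<in>Pow I'. if S \<subseteq> T then (fourier p I' f T)\<^sup>2 else 0"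
    have Q1: "?Q f1 \<le> (6 * ?s) ^ card S * M"
      by (rule insert.IH) (use insert.prems fin S b1 m1 in auto)
    have Q0: "?Q f0 \<le> (6 * ?s) ^ card S * (2 * M)"
      by (rule insert.IH) (use insert.prems fin S b0 m0 in auto)
    have "(\<Sum>T\<in>Pow I. if insert i S \<subseteq> T then (fourier p I f T)\<^sup>2 else 0) \<le>
        (\<Sum>T\<in>Pow I'. 2 * ?s * (if S \<subseteq> T then (fourier p I' f1 T)\<^sup>2 else 0) +
          2 * ?s * (if S \<subseteq> T then (fourier p I' f0 T)\<^sup>2 else 0))"
      unfolding I sum_Pow_insert[OF fin i]
    proof (intro sum_mono, goal_cases)
      case (1 T)
      then have T: "T \<subseteq> I'" "i \<notin> T" using i by auto
      have sub: "insert i S \<subseteq> insert i T \<longleftrightarrow> S \<subseteq> T" using insert.hyps by auto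
      have "(fourier p (insert i I') f (insert i T))\<^sup>2 = ?s * (fourier p I' f1 T - fourier p I' f0 T)\<^sup>2"
        using insert.prems fin i T s0
        by (simp add: fourier_insert_insert power_mult_distrib flip: f1_def f0_def)
      also have "\<dots> \<le> ?s * (2 * (fourier p I' f1 T)\<^sup>2 + 2 * (fourier p I' f0 T)\<^sup>2)"
        using s0 sum_squares_ge_zero[of "fourier p I' f1 T + fourier p I' f0 T" 0]
        by (intro mult_left_mono) (auto simp: power2_eq_square algebra_simps)
      finally show ?case using T sub by (auto simp: algebra_simps)
    qed
    also have "\<dots> = 2 * ?s * (?Q f1 + ?Q f0)"
      by (simp only: sum.distrib sum_distrib_left distrib_left)
    also have "\<dots> \<le> 2 * ?s * ((6 * ?s) ^ card S * M + (6 * ?s) ^ card S * (2 * M))"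
      using s0 Q1 Q0 by (intro mult_left_mono add_mono) auto
    also have "\<dots> = (6 * ?s) ^ card (insert i S) * M"
      using insert.hyps by (simp add: algebra_simps)
    finally show ?case .
  qed
qed

section \<open>Fourth moment of a low-degree function with small tails\<close>

lemma sum_Pow_power_card:
  fixes c :: real
  assumes "finite T"
  shows "(\<Sum>S\<in>Pow T. c ^ card S) = (1 + c) ^ card T"
  using prod_add[OF assms, of "\<lambda>_. c" "\<lambda>_. 1"] by (simp add: add.commute)

lemma low_degree_fourth_moment:
  fixes \<delta> :: real
  assumes fin: "finite I" and p: "0 < p" "p < 1" and \<delta>: "0 \<le> \<delta>"
    and deg: "\<And>T. T \<subseteq> I \<Longrightarrow> d < card T \<Longrightarrow> a T = 0"
    and tail: "\<And>S. S \<subseteq> I \<Longrightarrow> card S \<le> d \<Longrightarrow>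
      (\<Sum>T\<in>Pow I. if S \<subseteq> T then (a T)\<^sup>2 else 0) \<le> (12 * (p * (1 - p))) ^ card S * \<delta>"
  shows "mu p I (\<lambda>x. (fourier_sum p I a x)^4) \<le> 52 ^ d * \<delta> * (\<Sum>T\<in>Pow I. (a T)\<^sup>2)"
proof -
  let ?s = "p * (1 - p)" and ?N = "weighted_tail I a"
  have s0: "?s > 0" using p by simp
  have "mu p I (\<lambda>x. (fourier_sum p I a x)^4) =
      mu p I (\<lambda>x. (fourier_sum p I a x)\<^sup>2 * (fourier_sum p I a x)\<^sup>2)"
    by (simp flip: power_add)
  also have "\<dots> \<le> (\<Sum>S\<in>Pow I. (3 / (16 * ?s)) ^ card S * (?N S * ?N S))"
    by (rule global_hypercontractivity[OF fin p])
  also have "\<dots> \<le> (\<Sum>S\<in>Pow I. 4 ^ d * \<delta> * ((9 / 4) ^ card S * ?N S))"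
  proof (intro sum_mono, goal_cases)
    case (1 S)
    then have S: "S \<subseteq> I" by auto
    show ?case
    proof (cases "card S \<le> d")
      case True
      have "?N S \<le> (\<Sum>T\<in>Pow I. 4 ^ d * (if S \<subseteq> T then (a T)\<^sup>2 else 0))"
        unfolding weighted_tail_def
      proof (intro sum_mono, goal_cases)
        case (1 T)
        then show ?case
          using deg[of T] by (cases "card T \<le> d") (auto intro!: mult_right_mono power_increasing)
      qed
      also have "\<dots> \<le> 4 ^ d * ((12 * ?s) ^ card S * \<delta>)"
        unfolding sum_distrib_left[symmetric] using tail[OF S True] by (intro mult_left_mono) auto
      finally have N: "?N S \<le> 4 ^ d * ((12 * ?s) ^ card S * \<delta>)" .
      have "(3 / (16 * ?s)) ^ card S * (?N S * ?N S) \<le>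
          (3 / (16 * ?s)) ^ card S * ((4 ^ d * ((12 * ?s) ^ card S * \<delta>)) * ?N S)"
        using N s0 weighted_tail_nonneg by (intro mult_left_mono mult_right_mono) auto
      \<comment> \<open>The growth of the hypercontractive constant for small \<open>p\<close>
        cancels here against the decay of the tails, leaving a factor independent of
        \<open>p\<close>.\<close>
      also have "\<dots> = 4 ^ d * \<delta> * ((3 / (16 * ?s) * (12 * ?s)) ^ card S * ?N S)"
        unfolding power_mult_distrib by simp
      also have "3 / (16 * ?s) * (12 * ?s) = 9 / 4"
        using p by (simp add: field_simps)
      finally show ?thesis .
    next
      case False
      \<comment> \<open>A set containing \<open>S\<close> has more than \<open>d\<close> elements as
        well, so its coefficient vanishes.\<close>
      have "?N S = 0"
        unfolding weighted_tail_def
      proof (intro sum.neutral ballI, goal_cases)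
        case (1 T)
        then have T: "T \<subseteq> I" "finite T" using fin finite_subset by auto
        show ?case using card_mono[OF T(2), of S] False deg[OF T(1)] by auto
      qed
      then show ?thesis by simp
    qed
  qed
  \<comment> \<open>Exchanging the sums, each \<open>T\<close> collects
    \<open>(1 + 9 / 4) ^ card T\<close> from its subsets; with the weight 4 this is 13 per element,
    and 52 = 4 * 13.\<close>
  also have "\<dots> = 4 ^ d * \<delta> * (\<Sum>T\<in>Pow I. 13 ^ card T * (a T)\<^sup>2)"
  proof -
    have "(\<Sum>S\<in>Pow I. (9 / 4) ^ card S * ?N S) =
        (\<Sum>T\<in>Pow I. \<Sum>S\<in>Pow I. if S \<subseteq> T then (9 / 4) ^ card S * (4 ^ card T * (a T)\<^sup>2) else 0)"
      unfolding weighted_tail_def sum_distrib_left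
      by (subst sum.swap) (intro sum.cong refl, simp)
    also have "\<dots> = (\<Sum>T\<in>Pow I. 13 ^ card T * (a T)\<^sup>2)"
    proof (intro sum.cong refl, goal_cases)
      case (1 T)
      then have T: "T \<subseteq> I" "finite T" using fin finite_subset by auto
      have "(\<Sum>S\<in>Pow I. if S \<subseteq> T then (9 / 4) ^ card S * (4 ^ card T * (a T)\<^sup>2) else 0) =
          (\<Sum>S\<in>Pow T. (9 / 4) ^ card S * (4 ^ card T * (a T)\<^sup>2))"
        using T fin by (intro sum.mono_neutral_cong_right) auto
      also have "\<dots> = (1 + 9 / 4) ^ card T * (4 ^ card T * (a T)\<^sup>2)"
        by (simp only: sum_distrib_right[symmetric] sum_Pow_power_card[OF T(2)])
      also have "\<dots> = ((1 + 9 / 4) * 4) ^ card T * (a T)\<^sup>2"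
        by (simp only: power_mult_distrib mult.assoc)
      finally show ?case by simp
    qed
    finally show ?thesis by (simp only: sum_distrib_left[symmetric])
  qed
  also have "\<dots> \<le> 4 ^ d * \<delta> * (\<Sum>T\<in>Pow I. 13 ^ d * (a T)\<^sup>2)"
  proof (intro mult_left_mono sum_mono, goal_cases)
    case (1 T)
    then show ?case
      using deg[of T] by (cases "card T \<le> d") (auto intro!: mult_right_mono power_increasing)
  qed (use \<delta> in auto)
  also have "\<dots> = (4 * 13) ^ d * \<delta> * (\<Sum>T\<in>Pow I. (a T)\<^sup>2)"
    unfolding power_mult_distrib by (simp add: sum_distrib_left mult_ac)
  finally show ?thesis by simp
qed

section \<open>From the fourth moment to the low-degree weight\<close>

lemma mu_Cauchy_Schwarz:
  assumes "finite I"
  shows "(mu p I (\<lambda>x. f x * g x))\<^sup>2 \<le> mu p I (\<lambda>x. (f x)\<^sup>2) * mu p I (\<lambda>x. (g x)\<^sup>2)"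
proof -
  let ?A = "mu p I (\<lambda>x. (f x)\<^sup>2)" and ?B = "mu p I (\<lambda>x. f x * g x)" and ?C = "mu p I (\<lambda>x. (g x)\<^sup>2)"
  have q: "0 \<le> ?A + 2 * t * ?B + t\<^sup>2 * ?C" for t
  proof -
    have "0 \<le> mu p I (\<lambda>x. (f x + t * g x)\<^sup>2)"
      using assms by (intro mu_nonneg) auto
    also have "\<dots> = mu p I (\<lambda>x. (f x)\<^sup>2 + (2 * t) * (f x * g x) + t\<^sup>2 * (g x)\<^sup>2)"
      by (intro mu_cong assms) (simp add: power2_eq_square algebra_simps)
    also have "\<dots> = ?A + 2 * t * ?B + t\<^sup>2 * ?C"
      using assms by (simp only: mu_add mu_cmult)
    finally show ?thesis .
  qed
  have C0: "?C \<ge> 0" using assms by (intro mu_nonneg) auto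
  show ?thesis
  proof (cases "?C = 0")
    case True
    have "?B = 0"
    proof (rule ccontr)
      assume B: "?B \<noteq> 0"
      \<comment> \<open>When \<open>?C = 0\<close> the quadratic is linear in t, and this t gives it
        the value -1.\<close>
      show False using q[of "- (?A + 1) / (2 * ?B)"] True B by (simp add: field_simps)
    qed
    then show ?thesis using True by simp
  next
    case False
    with C0 have C: "?C > 0" by simp
    have "?A + 2 * (- ?B / ?C) * ?B + (- ?B / ?C)\<^sup>2 * ?C = ?A - ?B\<^sup>2 / ?C"
      using C by (simp add: field_simps power2_eq_square)
    with q[of "- ?B / ?C"] have "?B\<^sup>2 / ?C \<le> ?A" by linarith
    then show ?thesis using C by (simp add: pos_divide_le_eq)
  qed
qed

text \<open>Since \<open>f\<close> is its own square, a factor \<open>f\<close> can be split off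
  before each use of Cauchy-Schwarz: first from \<open>f * g\<close>, then from
  \<open>f * g^2\<close>.\<close>

lemma mu_boolean_times_pow4:
  assumes "finite I" "boolean_fun I f"
  shows "(mu p I (\<lambda>x. f x * g x))^4 \<le> (mu p I f)^3 * mu p I (\<lambda>x. (g x)^4)"
proof -
  let ?m = "mu p I f" and ?B = "mu p I (\<lambda>x. f x * g x)" and ?C = "mu p I (\<lambda>x. f x * (g x)\<^sup>2)"
  have m0: "?m \<ge> 0" by (rule mu_boolean_nonneg[OF assms])
  have f2: "(f x)\<^sup>2 = f x" if "x \<in> cube I" for x
    using boolean_fun_sq[OF assms(2) that] by (simp add: power2_eq_square)
  have e1: "mu p I (\<lambda>x. (f x)\<^sup>2) = ?m" by (intro mu_cong assms f2)
  have e2: "mu p I (\<lambda>x. f x * (f x * g x)) = ?B"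
    using assms by (intro mu_cong) (auto simp: boolean_fun_sq simp flip: mult.assoc)
  have e3: "mu p I (\<lambda>x. (f x * g x)\<^sup>2) = ?C"
    using assms f2 by (intro mu_cong) (auto simp: power_mult_distrib)
  have c1: "?B\<^sup>2 \<le> ?m * ?C"
    using mu_Cauchy_Schwarz[OF assms(1), of p f "\<lambda>x. f x * g x"] unfolding e1 e2 e3 .
  have c2: "?C\<^sup>2 \<le> ?m * mu p I (\<lambda>x. (g x)^4)"
    using mu_Cauchy_Schwarz[OF assms(1), of p f "\<lambda>x. (g x)\<^sup>2"] unfolding e1 by simp
  have "?B^4 = (?B\<^sup>2)\<^sup>2" by simp
  also have "\<dots> \<le> (?m * ?C)\<^sup>2" using c1 by (intro power_mono) auto
  also have "\<dots> = ?m\<^sup>2 * ?C\<^sup>2" by (simp add: power_mult_distrib)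
  also have "\<dots> \<le> ?m\<^sup>2 * (?m * mu p I (\<lambda>x. (g x)^4))" using c2 by (intro mult_left_mono) auto
  finally show ?thesis by (simp add: power2_eq_square power3_eq_cube mult_ac)
qed

text \<open>A level inequality for global functions. The cube of \<eta> arises because the weight
  \<open>W\<close> reappears linearly in the fourth-moment bound: cancelling it from
  \<open>W^4\<close> leaves a cube root to take.\<close>

theorem level_inequality:
  fixes \<delta> \<eta> :: real
  assumes fin: "finite I" and p: "0 < p" "p \<le> 1 / 2" and bool: "boolean_fun I f"
    and small: "mu p I f \<le> \<delta>"
    and global: "\<And>J. J \<subseteq> I \<Longrightarrow> card J \<le> d \<Longrightarrow> mu p (I - J) (restrict_to_1 f J) \<le> 2 * \<delta>"
    and \<eta>: "0 \<le> \<eta>" "52 ^ d * \<delta> \<le> \<eta>^3"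
  shows "(\<Sum>T | T \<subseteq> I \<and> card T \<le> d. (fourier p I f T)\<^sup>2) \<le> \<eta> * mu p I f"
proof -
  define a where "a T = (if card T \<le> d then fourier p I f T else 0)" for T
  define W where "W = (\<Sum>T\<in>Pow I. (a T)\<^sup>2)"
  have p1: "p < 1" using p by simp
  have m0: "0 \<le> mu p I f" by (rule mu_boolean_nonneg[OF fin bool])
  have \<delta>0: "0 \<le> \<delta>" using m0 small by simp
  have W0: "0 \<le> W" unfolding W_def by (intro sum_nonneg) auto
  have W_eq: "W = (\<Sum>T | T \<subseteq> I \<and> card T \<le> d. (fourier p I f T)\<^sup>2)"
    unfolding W_def using fin by (intro sum.mono_neutral_cong_right) (auto simp: a_def)
  have tail: "(\<Sum>T\<in>Pow I. if S \<subseteq> T then (a T)\<^sup>2 else 0) \<le> (12 * (p * (1 - p))) ^ card S * \<delta>"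
    if S: "S \<subseteq> I" "card S \<le> d" for S
  proof -
    have finS: "finite S" using S fin finite_subset by auto
    have le: "(\<Sum>T\<in>Pow I. if S \<subseteq> T then (a T)\<^sup>2 else 0) \<le>
        (\<Sum>T\<in>Pow I. if S \<subseteq> T then (fourier p I f T)\<^sup>2 else 0)"
      by (intro sum_mono) (auto simp: a_def)
    \<comment> \<open>For empty \<open>S\<close> Parseval gives \<delta> directly. For nonempty
      \<open>S\<close> the 2 in \<open>2 * \<delta>\<close> is at most \<open>2 ^ card S\<close>,
      which turns the 6 per coordinate into 12.\<close>
    show ?thesis
    proof (cases "S = {}")
      case True
      then show ?thesis using le parseval_boolean[OF fin p(1) p1 bool] small by simp
    next
      case False
      then have c: "card S \<ge> 1" using finS by (simp add: Suc_le_eq card_gt_0_iff)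
      have "(\<Sum>T\<in>Pow I. if S \<subseteq> T then (fourier p I f T)\<^sup>2 else 0) \<le>
          (6 * (p * (1 - p))) ^ card S * (2 * \<delta>)"
      proof (rule fourier_tail_bound[OF fin p S(1) bool])
        fix J assume "J \<subseteq> S"
        then show "mu p (I - J) (restrict_to_1 f J) \<le> 2 * \<delta>"
          using S card_mono[OF finS, of J] by (intro global) auto
      qed
      also have "\<dots> = (6 * (p * (1 - p))) ^ card S * \<delta> * 2 ^ 1" by simp
      also have "\<dots> \<le> (6 * (p * (1 - p))) ^ card S * \<delta> * 2 ^ card S"
        using c p \<delta>0 by (intro mult_left_mono power_increasing) auto
      also have "\<dots> = (2 * (6 * (p * (1 - p)))) ^ card S * \<delta>"
        unfolding power_mult_distrib by simp
      finally show ?thesis using le by simp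
    qed
  qed
  have "mu p I (\<lambda>x. f x * fourier_sum p I a x) = mu p I (\<lambda>x. \<Sum>T\<in>Pow I. a T * (f x * chi p T x))"
    by (simp add: fourier_sum_def sum_distrib_left mult_ac)
  also have "\<dots> = (\<Sum>T\<in>Pow I. a T * fourier p I f T)"
    by (simp add: mu_sum mu_cmult fin fourier_def)
  also have "\<dots> = W"
    unfolding W_def by (intro sum.cong) (auto simp: a_def power2_eq_square)
  finally have W: "mu p I (\<lambda>x. f x * fourier_sum p I a x) = W" .
  have "W^4 \<le> (mu p I f)^3 * mu p I (\<lambda>x. (fourier_sum p I a x)^4)"
    using mu_boolean_times_pow4[OF fin bool, of p "fourier_sum p I a"] unfolding W .
  also have "\<dots> \<le> (mu p I f)^3 * (52 ^ d * \<delta> * W)"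
    unfolding W_def
    by (intro mult_left_mono low_degree_fourth_moment fin p(1) p1 \<delta>0 tail) (use m0 in \<open>auto simp: a_def\<close>)
  also have "\<dots> \<le> (mu p I f)^3 * (\<eta>^3 * W)"
    using \<eta> m0 W0 by (intro mult_left_mono mult_right_mono) auto
  also have "\<dots> = (\<eta> * mu p I f)^3 * W"
    by (simp add: power_mult_distrib)
  finally have *: "W^3 * W \<le> (\<eta> * mu p I f)^3 * W"
    by (simp add: power3_eq_cube power4_eq_xxxx)
  have "W \<le> \<eta> * mu p I f"
  proof (cases "W = 0")
    case True
    then show ?thesis using \<eta> m0 by simp
  next
    case False
    with * W0 have "W^3 \<le> (\<eta> * mu p I f)^3" by simp
    then show ?thesis using \<eta> m0 W0 by simp
  qed
  then show ?thesis by (simp add: W_eq)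
qed

section \<open>Stability, splitting the Fourier levels at the threshold\<close>

theorem theorem6p1:
  fixes p \<rho> \<epsilon> r \<delta> :: real and n :: nat and f :: "(nat \<Rightarrow> bool) \<Rightarrow> real"
  assumes "0 < p" and "p \<le> 1 / 2"
    and "0 < \<rho>" and "\<rho> < 1"
    and "\<epsilon> > 0"
    and "r = ln (2 / \<epsilon>) / ln (1 / \<rho>)"
    and "\<delta> = 10 powr (- 3 * r - 1) * \<epsilon> ^ 3"
    and "boolean_fun {1..n} f"
    and "global_fun p {1..n} r \<delta> f"
    and "mu p {1..n} f < \<delta>"
  shows "Stab p {1..n} \<rho> f \<le> \<epsilon> * mu p {1..n} f"
proof -
  let ?I = "{1..n}"
  let ?w = "\<lambda>T. (fourier p ?I f T)\<^sup>2"
  have p1: "p < 1" using assms by simp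
  have m0: "0 \<le> mu p ?I f" by (rule mu_boolean_nonneg) (use assms in auto)
  have total: "(\<Sum>T\<in>Pow ?I. ?w T) = mu p ?I f"
    by (rule parseval_boolean) (use assms p1 in auto)
  have stab: "Stab p ?I \<rho> f = (\<Sum>T\<in>Pow ?I. \<rho> ^ card T * ?w T)"
    unfolding Stab_def using assms p1 by (simp add: noise_form_expansion power2_eq_square)
  show ?thesis
  \<comment> \<open>For large \<epsilon> it is enough that noise does not increase the Fourier
    weight. Otherwise \<open>r\<close> is positive, so the natural number \<open>d\<close> really is
    its floor.\<close>
  proof (cases "\<epsilon> \<ge> 1")
    case True
    have "Stab p ?I \<rho> f \<le> (\<Sum>T\<in>Pow ?I. ?w T)"
      unfolding stab using assms by (intro sum_mono) (auto intro!: mult_left_le_one_le power_le_one)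
    also have "\<dots> \<le> \<epsilon> * mu p ?I f"
      unfolding total using True m0 mult_right_mono[of 1 \<epsilon> "mu p ?I f"] by simp
    finally show ?thesis .
  next
    case False
    have r0: "r > 0" unfolding assms(6) using False assms by (intro divide_pos_pos) auto
    define d where "d = nat \<lfloor>r\<rfloor>"
    have d_less: "real k > r" if "k > d" for k
      using r0 that unfolding d_def by linarith+
    have dr: "real d \<le> r" using r0 unfolding d_def by linarith
    have \<rho>r: "\<rho> powr r = \<epsilon> / 2"
    proof -
      have "r * ln \<rho> = - ln (2 / \<epsilon>)"
        unfolding assms(6) using assms by (simp add: ln_div)
      then have "\<rho> powr r = exp (- ln (2 / \<epsilon>))"
        using assms by (simp add: powr_def)
      then show ?thesis using assms by (simp add: exp_minus)
    qed
    have low: "(\<Sum>T | T \<subseteq> ?I \<and> card T \<le> d. ?w T) \<le> \<epsilon> / 2 * mu p ?I f"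
    proof (rule level_inequality)
      fix J assume "J \<subseteq> ?I" "card J \<le> d"
      then have "mu p (?I - J) (restrict_to_1 f J) \<le> mu p ?I f + \<delta>"
        using assms(9) dr unfolding global_fun_def by auto
      then show "mu p (?I - J) (restrict_to_1 f J) \<le> 2 * \<delta>" using assms by simp
    next
      \<comment> \<open>The factor 10 to the power -3r in \<delta> is there to cancel
        \<open>1000 powr r\<close>; the remaining 1/10 is below the 1/8 that comes from cubing
        \<epsilon>/2.\<close>
      have "(52::real) ^ d \<le> 1000 ^ d" by (intro power_mono) auto
      also have "\<dots> = 1000 powr real d" by (simp add: powr_realpow)
      also have "\<dots> \<le> 1000 powr r" using dr by (intro powr_mono) auto
      also have "\<dots> = (10 powr 3) powr r" by simp
      also have "\<dots> = 10 powr (3 * r)" by (simp only: powr_powr)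
      finally have "52 ^ d * \<delta> \<le> 10 powr (3 * r) * (10 powr (- 3 * r - 1) * \<epsilon>^3)"
        unfolding assms(7) using assms by (intro mult_right_mono) auto
      also have "\<dots> = 10 powr (3 * r + (- 3 * r - 1)) * \<epsilon>^3"
        by (simp only: powr_add mult.assoc)
      also have "\<dots> = \<epsilon>^3 / 10" by (simp add: powr_minus)
      also have "\<dots> \<le> (\<epsilon> / 2)^3" using assms by (simp add: power_divide)
      finally show "52 ^ d * \<delta> \<le> (\<epsilon> / 2)^3" .
    qed (use assms in auto)
    \<comment> \<open>The \<epsilon>/2 term is needed only above level \<open>d\<close>, but
      granting it to every \<open>T\<close> lets Parseval sum it to
      \<open>\<epsilon> / 2 * mu p ?I f\<close>.\<close>
    have "Stab p ?I \<rho> f \<le> (\<Sum>T\<in>Pow ?I. (if card T \<le> d then ?w T else 0) + \<epsilon> / 2 * ?w T)"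
      unfolding stab
    proof (intro sum_mono, goal_cases)
      case (1 T)
      show ?case
      proof (cases "card T \<le> d")
        case True
        have "\<rho> ^ card T * ?w T \<le> ?w T"
          using assms by (intro mult_left_le_one_le) (auto intro: power_le_one)
        moreover have "0 \<le> \<epsilon> / 2 * ?w T" using assms by simp
        ultimately show ?thesis using True by simp
      next
        case False
        have "\<rho> ^ card T = \<rho> powr real (card T)" using assms by (simp add: powr_realpow)
        also have "\<dots> \<le> \<rho> powr r"
          using assms d_less[of "card T"] False by (intro powr_mono') auto
        finally have "\<rho> ^ card T * ?w T \<le> \<epsilon> / 2 * ?w T"
          unfolding \<rho>r by (rule mult_right_mono) simp
        then show ?thesis using False by simp
      qed
    qed
    also have "\<dots> = (\<Sum>T | T \<subseteq> ?I \<and> card T \<le> d. ?w T) + \<epsilon> / 2 * mu p ?I f"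
    proof -
      have "(\<Sum>T\<in>Pow ?I. if card T \<le> d then ?w T else 0) = (\<Sum>T | T \<subseteq> ?I \<and> card T \<le> d. ?w T)"
        by (intro sum.mono_neutral_cong_right) auto
      then show ?thesis unfolding sum.distrib sum_distrib_left[symmetric] total by simp
    qed
    finally show ?thesis using low by simp
  qed
qed

end
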